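(* Let $n$ be a positive integer. The number of Stirling permutations of order $n$ whose displacement composition has exactly $n$ nonzero parts (entries) is the $n$th Catalan number $C_n=\frac{1}{n+1}\binom{2n}{n}$.
   Context: A Stirling permutation of order $n$ is a permutation $w = w(1)w(2)\cdots w(2n)$ of the multiset $\{1,1,2,2,\ldots,n,n\}$ such that any value $j$ appearing between the two instances of $i$ satisfies $j>i$. $Q_n$ denotes the set of Stirling permutations of order $n$. Parking interpretation: there is a one-way street with spots $1,\ldots,2n$ (in this order), and cars $1,2,\ldots,2n$ arrive in order, car $i$ having preferred spot $w(i)$. Car $i$ parks in spot $w(i)$ if it is available; otherwise it continues down the street and parks in the first available spot after $w(i)$. For every $w\in Q_n$ all cars park. If car $i$ parks in spot $p(i)$, its displacement is $d(i)=p(i)-w(i)$. The displacement composition of $w\in Q_n$ is the tuple $\mathrm{dis}(w)=(d(1),d(2),\ldots,d(2n))\in\mathbb{N}^{2n}$, where $\mathbb{N}=\{0,1,2,\ldots\}$. *)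

theory Defs
  imports Complex_Main "HOL-Library.Multiset"
begin

text \<open>
  A word \<open>w(1) \<dots> w(2n)\<close> is a list, so \<open>w(i)\<close> is \<open>w ! (i - 1)\<close>; letters and parking spots
  keep their values \<open>1, 2, \<dots>\<close>.
\<close>

definition stirling_permutations :: "nat \<Rightarrow> nat list set" where
  "stirling_permutations n =
     {w. mset w = mset_set {1..n} + mset_set {1..n} \<and>
         (\<forall>a b c. a < b \<and> b < c \<and> c < length w \<and> w ! a = w ! c \<longrightarrow> w ! b > w ! a)}"

text \<open>
  The street has spots \<open>1, \<dots>, m\<close>. If no spot \<open>s \<ge> a\<close> is available, the value of
  \<open>parking_spot m occ a\<close> is unspecified; this never happens when the preferences
  form a Stirling permutation of order \<open>n\<close> and \<open>m = 2 * n\<close>.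
\<close>

definition parking_spot :: "nat \<Rightarrow> nat set \<Rightarrow> nat \<Rightarrow> nat" where
  "parking_spot m occ a = (LEAST s. s \<in> {1..m} \<and> a \<le> s \<and> s \<notin> occ)"

fun park :: "nat \<Rightarrow> nat set \<Rightarrow> nat list \<Rightarrow> nat list" where
  "park m occ [] = []"
| "park m occ (a # w) =
     parking_spot m occ a # park m (insert (parking_spot m occ a) occ) w"

text \<open>
  The street is as long as the number of cars. The subtraction on \<open>nat\<close> does not truncate,
  since a car that parks does so at or after its preferred spot.
\<close>

definition displacement_composition :: "nat list \<Rightarrow> nat list" where
  "displacement_composition w = map2 (-) (park (length w) {} w) w"

end

theory Submission
  imports Defs
begin

text \<open>
  At most one car preferring a given spot can be lucky (displacement zero), so exactly \<open>n\<close> entries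
  are nonzero iff every spot \<open>i \<le> n\<close> is taken by a car preferring it. This happens iff the second
  copy of each letter \<open>i\<close> arrives only after all larger letters have occurred, since it then finds
  all spots \<open>i, \<dots>, n\<close> occupied. A Stirling permutation with this property has the form
  \<open>A 1 B 1\<close> with words \<open>A\<close>, \<open>B\<close> of the same kind and all letters of \<open>A\<close> larger than all letters
  of \<open>B\<close>, which is the Catalan recurrence.
\<close>

section \<open>The parking process\<close>

text \<open>These conditions determine \<open>p\<close> from \<open>w\<close> and do not mention the
  length of the street, so later arguments need neither \<open>LEAST\<close> nor the unspecified
  value in \<open>parking_spot\<close>.\<close>

definition parks :: "nat list \<Rightarrow> nat list \<Rightarrow> bool" where
  "parks w p \<longleftrightarrow> length p = length w \<and>
     (\<forall>k<length w. w ! k \<le> p ! k \<and> (\<forall>j<k. p ! j \<noteq> p ! k) \<and>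
        (\<forall>s. w ! k \<le> s \<and> s < p ! k \<longrightarrow> (\<exists>j<k. p ! j = s)))"

lemma length_park [simp]: "length (park m occ w) = length w"
  by (induction w arbitrary: occ) (auto simp: Let_def)

lemma nth_park:
  "k < length w \<Longrightarrow>
   park m occ w ! k = parking_spot m (occ \<union> set (take k (park m occ w))) (w ! k)"
proof (induction w arbitrary: occ k)
  case (Cons a w)
  then show ?case by (cases k) auto
qed simp

text \<open>Least \<open>b\<close> with \<open>{b..m}\<close> fully occupied: nobody preferring a spot below \<open>b\<close> has parked
  in \<open>{b..m}\<close>, so too many cars prefer a spot in it.\<close>

lemma parks_park:
  assumes pos: "\<And>a. a \<in> set w \<Longrightarrow> 1 \<le> a"
    and cnt: "\<And>b. 1 \<le> b \<Longrightarrow> b \<le> length w + 1 \<Longrightarrow>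
                card {j. j < length w \<and> b \<le> w ! j} + b \<le> length w + 1"
  shows "parks w (park (length w) {} w)"
proof -
  define m where "m = length w"
  define p where "p = park m {} w"
  define Q where "Q k \<longleftrightarrow> w ! k \<le> p ! k \<and> (\<forall>j<k. p ! j \<noteq> p ! k) \<and>
        (\<forall>s. w ! k \<le> s \<and> s < p ! k \<longrightarrow> (\<exists>j<k. p ! j = s))" for k
  have lp: "length p = m" by (simp add: p_def m_def)
  have "k < m \<Longrightarrow> Q k" for k
  proof (induction k rule: less_induct)
    case (less k)
    define occ where "occ = (!) p ` {..<k}"
    have tk: "set (take k p) = occ"
      using less.prems lp unfolding occ_def by (simp add: nth_image[symmetric] lessThan_atLeast0)
    have pk: "p ! k = (LEAST s. s \<in> {1..m} \<and> w ! k \<le> s \<and> s \<notin> occ)"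
      using nth_park[of k w m "{}"] less.prems tk
      by (simp add: p_def[symmetric] m_def[symmetric] parking_spot_def)
    have wk: "1 \<le> w ! k" using pos less.prems m_def by simp
    have "\<exists>s. s \<in> {1..m} \<and> w ! k \<le> s \<and> s \<notin> occ"
    proof (rule ccontr)
      assume none: "\<not> ?thesis"
      define R where "R b \<longleftrightarrow> 1 \<le> b \<and> {b..m} \<subseteq> occ" for b
      define b where "b = (LEAST b. R b)"
      \<comment> \<open>The cap at \<open>m + 1\<close> covers a preference beyond the end of the
        street, where the interval \<open>{b..m}\<close> is empty.\<close>
      have R0: "R (min (w ! k) (m + 1))" using none wk by (auto simp: R_def min_def)
      have Rb: "R b" unfolding b_def using R0 by (rule LeastI)
      have ble: "b \<le> w ! k" "b \<le> m + 1"
        using Least_le[of R "min (w ! k) (m + 1)"] R0 by (auto simp: b_def)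
      have prev: "b = 1 \<or> b - 1 \<notin> occ"
      proof (rule ccontr)
        assume c: "\<not> ?thesis"
        have "{b - 1..m} \<subseteq> occ"
        proof
          fix x assume "x \<in> {b - 1..m}"
          then have "x = b - 1 \<or> x \<in> {b..m}" by auto
          then show "x \<in> occ" using c Rb by (auto simp: R_def)
        qed
        then have "R (b - 1)" using c Rb by (auto simp: R_def)
        then have "b \<le> b - 1" unfolding b_def by (rule Least_le)
        then show False using Rb unfolding R_def by linarith
      qed
      have sub: "{b..m} \<subseteq> (!) p ` {j. j < k \<and> b \<le> w ! j}"
      proof
        fix x assume x: "x \<in> {b..m}"
        then obtain j where j: "j < k" "x = p ! j" using Rb by (auto simp: R_def occ_def)
        have Qj: "Q j" using less.IH[of j] j less.prems by simp
        have "b \<le> w ! j"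
        proof (rule ccontr)
          assume n: "\<not> b \<le> w ! j"
          have "1 \<le> w ! j" using pos j less.prems m_def by simp
          then have "b \<noteq> 1" using n by simp
          \<comment> \<open>Car \<open>j\<close> would have driven past spot \<open>b - 1\<close>,
            which must then have been occupied, against the minimality of \<open>b\<close>.\<close>
          have "w ! j \<le> b - 1" "b - 1 < p ! j" using n x j Rb by (auto simp: R_def)
          then obtain j' where j': "j' < j" "p ! j' = b - 1" using Qj unfolding Q_def by blast
          then have "p ! j' \<in> occ" using j unfolding occ_def by (intro imageI) simp
          then have "b - 1 \<in> occ" using j' by simp
          then show False using prev \<open>b \<noteq> 1\<close> by simp
        qed
        then show "x \<in> (!) p ` {j. j < k \<and> b \<le> w ! j}" using j by auto
      qed
      have "m + 1 - b \<le> card {j. j < k \<and> b \<le> w ! j}"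
        using surj_card_le[OF _ sub] by simp
      \<comment> \<open>Strict, because car \<open>k\<close> itself prefers a spot from
        \<open>b\<close> on and has not parked yet.\<close>
      also have "\<dots> < card {j. j < m \<and> b \<le> w ! j}"
        by (rule psubset_card_mono) (use less.prems ble in auto)
      also have "\<dots> \<le> m + 1 - b"
        using cnt[of b] ble Rb by (simp add: m_def R_def)
      finally show False by simp
    qed
    from LeastI_ex[OF this, folded pk] have 1: "p ! k \<in> {1..m}" "w ! k \<le> p ! k" "p ! k \<notin> occ"
      by auto
    have "s \<in> occ" if "w ! k \<le> s" "s < p ! k" for s
      using not_less_Least[OF that(2)[unfolded pk]] that 1 wk by auto
    then have "\<exists>j<k. p ! j = s" if "w ! k \<le> s" "s < p ! k" for s
      using that unfolding occ_def by fastforce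
    moreover have "\<forall>j<k. p ! j \<noteq> p ! k" using 1(3) unfolding occ_def by (metis imageI lessThan_iff)
    ultimately show "Q k" using 1(2) unfolding Q_def by blast
  qed
  then show ?thesis using lp unfolding parks_def Q_def m_def p_def by simp
qed

section \<open>Lucky cars and late repeats\<close>

text \<open>The explicit bound \<open>h\<close> allows the condition to be stated for factors of a
  word, whose letters fill shorter intervals.\<close>

definition late_repeats :: "nat \<Rightarrow> nat list \<Rightarrow> bool" where
  "late_repeats h w \<longleftrightarrow>
     (\<forall>a c j. a < c \<longrightarrow> c < length w \<longrightarrow> w ! a = w ! c \<longrightarrow> w ! c < j \<longrightarrow> j < h \<longrightarrow>
        (\<exists>k<c. w ! k = j))"

lemma parks_le: "parks w p \<Longrightarrow> k < length w \<Longrightarrow> w ! k \<le> p ! k"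
  by (simp add: parks_def)

lemma parks_skipped:
  "parks w p \<Longrightarrow> k < length w \<Longrightarrow> w ! k \<le> s \<Longrightarrow> s < p ! k \<Longrightarrow> \<exists>j<k. p ! j = s"
  unfolding parks_def by blast

lemma parks_inj:
  assumes "parks w p" "i < length w" "j < length w" "p ! i = p ! j"
  shows "i = j"
  using assms unfolding parks_def by (metis nat_neq_iff)

text \<open>Left to right, a repeat that comes before some larger letter \<open>j\<close> is forced
  to be the lucky car of its spot, although an equal preference came earlier. Right to left, the
  first car preferring \<open>i\<close> turns out to be lucky, by induction on
  \<open>i\<close>.\<close>

lemma all_spots_lucky_iff:
  assumes p: "parks w p" and w: "set w = {1..n}"
  shows "(\<forall>i\<in>{1..n}. \<exists>k<length w. w ! k = i \<and> p ! k = i) \<longleftrightarrow> late_repeats (Suc n) w"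
proof
  assume L: "\<forall>i\<in>{1..n}. \<exists>k<length w. w ! k = i \<and> p ! k = i"
  show "late_repeats (Suc n) w"
    unfolding late_repeats_def
  proof (intro allI impI, rule ccontr)
    fix a c j
    assume ac: "a < c" "c < length w" "w ! a = w ! c" "w ! c < j" "j < Suc n"
      and no: "\<not> (\<exists>k<c. w ! k = j)"
    have wc: "1 \<le> w ! c" using nth_mem[OF ac(2)] w by simp
    have "j \<in> {1..n}" using ac(4,5) by simp
    with L obtain k where k: "k < length w" "w ! k = j" "p ! k = j" by blast
    have "k \<noteq> c" using k(2) ac(4) by (metis less_irrefl)
    moreover have "\<not> k < c" using no k(2) by blast
    ultimately have "c < k" by linarith
    \<comment> \<open>Otherwise spot \<open>j\<close> is occupied before car \<open>c\<close>
      arrives, while its lucky car \<open>k\<close> comes only after \<open>c\<close>.\<close>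
    have "p ! c \<le> j"
    proof (rule ccontr)
      assume "\<not> p ! c \<le> j"
      then have "\<exists>j'<c. p ! j' = j" using ac(4) by (intro parks_skipped[OF p ac(2)]) linarith+
      then obtain j' where j': "j' < c" "p ! j' = j" by blast
      have "j' < length w" using j'(1) ac(2) by linarith
      then have "j' = k" by (rule parks_inj[OF p _ k(1)]) (simp only: j'(2) k(3))
      then show False using j'(1) \<open>c < k\<close> by linarith
    qed
    moreover have "w ! c \<le> p ! c" by (rule parks_le[OF p ac(2)])
    ultimately have "p ! c \<in> {1..n}" using ac(5) wc by simp
    \<comment> \<open>Some lucky car stands on spot \<open>p ! c\<close>, and it can only be
      \<open>c\<close>.\<close>
    then obtain k' where k': "k' < length w" "w ! k' = p ! c" "p ! k' = p ! c"
      using L by blast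
    have "k' = c" by (rule parks_inj[OF p k'(1) ac(2) k'(3)])
    then have pc: "w ! c = p ! c" using k'(2) by simp
    \<comment> \<open>Displaced or not, car \<open>a\<close> leaves the spot \<open>w ! a\<close>
      occupied, so car \<open>c\<close> cannot obtain it.\<close>
    show False
    proof (cases "w ! a < p ! a")
      case True
      then have "\<exists>j'<a. p ! j' = w ! a" using ac(1,2) by (intro parks_skipped[OF p]) linarith+
      then obtain j' where j': "j' < a" "p ! j' = w ! a" by blast
      have "p ! j' = p ! c" by (simp only: j'(2) ac(3) pc)
      moreover have "j' < length w" using j'(1) ac(1,2) by linarith
      ultimately have "j' = c" using parks_inj[OF p _ ac(2)] by blast
      then show False using ac(1) j'(1) by simp
    next
      case False
      have "a < length w" using ac by linarith
      with False have "p ! a = p ! c" using parks_le[OF p, of a] ac(3) pc by linarith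
      then have "a = c" by (rule parks_inj[OF p \<open>a < length w\<close> ac(2)])
      then show False using ac(1) by simp
    qed
  qed
next
  assume C: "late_repeats (Suc n) w"
  have "i \<in> {1..n} \<Longrightarrow> k < length w \<Longrightarrow> w ! k = i \<Longrightarrow> \<forall>j<k. w ! j \<noteq> i \<Longrightarrow> p ! k = i" for i k
  proof (induction i arbitrary: k rule: less_induct)
    case (less i)
    show ?case
    proof (rule ccontr)
      assume "p ! k \<noteq> i"
      moreover have "w ! k \<le> p ! k" by (rule parks_le[OF p less.prems(2)])
      ultimately have "i < p ! k" using less.prems(3) by linarith
      then have "\<exists>c<k. p ! c = i" using less.prems(2,3) by (intro parks_skipped[OF p]) linarith+
      then obtain c where c: "c < k" "p ! c = i" by blast
      have cl: "c < length w" using c(1) less.prems(2) by linarith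
      have "w ! c \<noteq> i" using c(1) less.prems(4) by blast
      then have ci: "w ! c < i" using parks_le[OF p cl] c(2) by linarith
      have wc: "w ! c \<in> {1..n}" using w nth_mem[OF cl] by blast
      \<comment> \<open>Car \<open>c\<close> holds spot \<open>i\<close> but prefers a smaller one.
        If it is the first with its preference, it is lucky by induction and so not at
        \<open>i\<close>; if it repeats a letter, then \<open>i\<close> has occurred before
        \<open>c\<close>, and car \<open>k\<close> is not the first to prefer
        \<open>i\<close>.\<close>
      show False
      proof (cases "\<forall>j<c. w ! j \<noteq> w ! c")
        case True
        then have "p ! c = w ! c" by (intro less.IH[OF ci wc cl]) simp_all
        then show False using c(2) ci by linarith
      next
        case False
        then obtain a where a: "a < c" "w ! a = w ! c" by blast
        have "i < Suc n" using less.prems(1) by simp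
        then obtain b where b: "b < c" "w ! b = i"
          using C[unfolded late_repeats_def, rule_format, OF a(1) cl a(2) ci] by blast
        have "b < k" using b(1) c(1) by linarith
        then show False using less.prems(4) b(2) by blast
      qed
    qed
  qed note * = this
  show "\<forall>i\<in>{1..n}. \<exists>k<length w. w ! k = i \<and> p ! k = i"
  proof
    fix i assume i: "i \<in> {1..n}"
    then have ex: "\<exists>k. k < length w \<and> w ! k = i" using w by (metis in_set_conv_nth)
    then obtain k where k: "k < length w" "w ! k = i"
      and first: "\<forall>j<k. \<not> (j < length w \<and> w ! j = i)"
      unfolding exists_least_iff[of "\<lambda>k. k < length w \<and> w ! k = i"] by blast
    have "\<forall>j<k. w ! j \<noteq> i" using first less_trans[of _ k "length w"] k(1) by blast
    then show "\<exists>k<length w. w ! k = i \<and> p ! k = i" using *[OF i k] k by blast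
  qed
qed

text \<open>Half-open intervals make cutting at a letter \<open>m\<close> free of subtractions; the
  letters \<open>1, \<dots>, n\<close> are the case \<open>l = 1\<close>,
  \<open>h = Suc n\<close>.\<close>

definition double_word :: "nat \<Rightarrow> nat \<Rightarrow> nat list \<Rightarrow> bool" where
  "double_word l h w \<longleftrightarrow> mset w = mset_set {l..<h} + mset_set {l..<h}"

text \<open>Lucky cars with equal preferences would share a spot, so \<open>(!) w\<close> is
  injective on the set \<open>Z\<close> of lucky cars. Having \<open>n\<close> of the
  \<open>2 * n\<close> cars displaced therefore means that the preferences of lucky cars exhaust
  \<open>{1..n}\<close>.\<close>

lemma card_nonzero_displacement_iff:
  assumes w: "double_word 1 (Suc n) w"
  shows "card {i. i < length (displacement_composition w) \<and> displacement_composition w ! i \<noteq> 0} = n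
    \<longleftrightarrow> late_repeats (Suc n) w"
proof -
  have mw: "mset w = mset_set {1..n} + mset_set {1..n}"
    using w by (simp add: double_word_def atLeastLessThanSuc_atLeastAtMost)
  have len: "length w = 2 * n" using arg_cong[OF mw, of size] by simp
  have sw: "set w = {1..n}" using arg_cong[OF mw, of set_mset] by simp
  define p where "p = park (length w) {} w"
  \<comment> \<open>For \<open>b \<le> n\<close>, the \<open>2 * (n + 1 - b)\<close> cars preferring
    a spot from \<open>b\<close> on have \<open>2 * n + 1 - b\<close> spots there, which suffices
    since \<open>b \<ge> 1\<close>; for larger \<open>b\<close> there are no such cars.\<close>
  have cnt: "card {j. j < length w \<and> b \<le> w ! j} + b \<le> length w + 1"
    if b: "1 \<le> b" "b \<le> length w + 1" for b
  proof -
    have "card {j. j < length w \<and> b \<le> w ! j} = size (filter_mset ((\<le>) b) (mset w))"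
      by (simp add: length_filter_conv_card[symmetric] flip: mset_filter)
    also have "\<dots> = 2 * card {x \<in> {1..n}. b \<le> x}"
      by (simp add: mw filter_mset_mset_set)
    also have "{x \<in> {1..n}. b \<le> x} = {b..n}" using b by auto
    finally show ?thesis using b len by simp
  qed
  have pk: "parks w p" unfolding p_def by (rule parks_park) (use sw cnt in auto)
  have lp: "length p = 2 * n" using pk len by (simp add: parks_def)
  define Z where "Z = {i. i < 2 * n \<and> p ! i = w ! i}"
  have nz: "{i. i < length (displacement_composition w) \<and> displacement_composition w ! i \<noteq> 0}
      = {..<2 * n} - Z"
  proof -
    have "displacement_composition w ! i = p ! i - w ! i \<and> w ! i \<le> p ! i" if "i < 2 * n" for i
      using that pk len lp unfolding displacement_composition_def p_def[symmetric] by (simp add: parks_def)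
    moreover have "length (displacement_composition w) = 2 * n"
      using len lp by (simp add: displacement_composition_def p_def[symmetric])
    ultimately show ?thesis by (force simp: Z_def)
  qed
  have Zsub: "Z \<subseteq> {..<2 * n}" by (auto simp: Z_def)
  have "card Z \<le> 2 * n" using card_mono[OF _ Zsub] by simp
  have "card ({..<2 * n} - Z) = 2 * n - card Z"
    by (subst card_Diff_subset) (use Zsub in \<open>auto intro: finite_subset\<close>)
  then have 1: "card ({..<2 * n} - Z) = n \<longleftrightarrow> card Z = n" using \<open>card Z \<le> 2 * n\<close> by auto
  have "x = y" if "x \<in> Z" "y \<in> Z" "w ! x = w ! y" for x y
  proof (rule parks_inj[OF pk])
    show "x < length w" "y < length w" "p ! x = p ! y" using that len by (simp_all add: Z_def)
  qed
  then have inj: "inj_on ((!) w) Z" by (rule inj_onI)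
  have sub: "(!) w ` Z \<subseteq> {1..n}"
  proof
    fix x assume "x \<in> (!) w ` Z"
    then obtain k where "k < length w" "x = w ! k" using len by (auto simp: Z_def)
    then show "x \<in> {1..n}" using nth_mem[of k w] sw by simp
  qed
  have "card ((!) w ` Z) = card Z" by (rule card_image[OF inj])
  then have "card Z = n \<longleftrightarrow> card ((!) w ` Z) = card {1..n}" by simp
  also have "\<dots> \<longleftrightarrow> (!) w ` Z = {1..n}"
    using card_subset_eq[OF finite_atLeastAtMost sub] by metis
  also have "\<dots> \<longleftrightarrow> {1..n} \<subseteq> (!) w ` Z" using sub by blast
  also have "\<dots> \<longleftrightarrow> (\<forall>i\<in>{1..n}. \<exists>k<length w. w ! k = i \<and> p ! k = i)"
  proof -
    have "i \<in> (!) w ` Z \<longleftrightarrow> (\<exists>k<length w. w ! k = i \<and> p ! k = i)" for i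
      unfolding Z_def len by (auto simp: image_def)
    then show ?thesis by (simp only: subset_iff Ball_def)
  qed
  also have "\<dots> \<longleftrightarrow> late_repeats (Suc n) w" by (rule all_spots_lucky_iff[OF pk sw])
  finally show ?thesis using nz 1 by simp
qed

section \<open>Cutting words at their smallest letter\<close>

text \<open>The Stirling condition, separated from the choice of letters so that it passes to
  factors of a word.\<close>

definition nested :: "nat list \<Rightarrow> bool" where
  "nested w \<longleftrightarrow>
     (\<forall>a b c. a < b \<and> b < c \<and> c < length w \<and> w ! a = w ! c \<longrightarrow> w ! b > w ! a)"

lemma nestedD:
  "nested w \<Longrightarrow> a < b \<Longrightarrow> b < c \<Longrightarrow> c < length w \<Longrightarrow> w ! a = w ! c \<Longrightarrow> w ! a < w ! b"
  unfolding nested_def by blast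

lemma late_repeatsD:
  "late_repeats h w \<Longrightarrow> a < c \<Longrightarrow> c < length w \<Longrightarrow> w ! a = w ! c \<Longrightarrow> w ! c < j \<Longrightarrow> j < h
   \<Longrightarrow> \<exists>k<c. w ! k = j"
  unfolding late_repeats_def by blast

lemma nested_append:
  assumes "nested (X @ Y)"
  shows "nested X" "nested Y"
proof -
  show "nested X"
    unfolding nested_def
  proof (intro allI impI)
    fix a b c assume "a < b \<and> b < c \<and> c < length X \<and> X ! a = X ! c"
    then show "X ! a < X ! b"
      using nestedD[OF assms, of a b c] by (simp add: nth_append)
  qed
  show "nested Y"
    unfolding nested_def
  proof (intro allI impI)
    fix a b c assume "a < b \<and> b < c \<and> c < length Y \<and> Y ! a = Y ! c"
    then show "Y ! a < Y ! b"
      using nestedD[OF assms, of "length X + a" "length X + b" "length X + c"] by simp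
  qed
qed

text \<open>Stated for the prefix alone: the earlier occurrences demanded by a repeat in
  \<open>Y\<close> may lie in \<open>X\<close>.\<close>

lemma late_repeats_appendD:
  assumes "late_repeats h (X @ Y)"
  shows "late_repeats h X"
  unfolding late_repeats_def
proof (intro allI impI)
  fix a c j assume *: "a < c" "c < length X" "X ! a = X ! c" "X ! c < j" "j < h"
  then obtain k where "k < c" "(X @ Y) ! k = j"
    using late_repeatsD[OF assms, of a c j] by (auto simp: nth_append)
  then show "\<exists>k<c. X ! k = j" using * by (auto simp: nth_append)
qed

lemma double_word_iff_count:
  "double_word l h w \<longleftrightarrow> (\<forall>x. count (mset w) x = (if l \<le> x \<and> x < h then 2 else 0))"
  unfolding double_word_def multiset_eq_iff by (simp add: count_mset_set' numeral_2_eq_2)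

lemma set_double_word: "double_word l h w \<Longrightarrow> set w = {l..<h}"
  unfolding double_word_def by (drule arg_cong[of _ _ set_mset]) simp

lemma length_double_word: "double_word l h w \<Longrightarrow> length w = 2 * (h - l)"
  unfolding double_word_def by (drule arg_cong[of _ _ size]) simp

lemma count_two_split:
  assumes "count (mset w) x = 2"
  obtains X Y Z where "w = X @ x # Y @ x # Z" "x \<notin> set X" "x \<notin> set Y" "x \<notin> set Z"
proof -
  have "x \<in> set w" using assms by (metis count_mset_0_iff zero_neq_numeral)
  then obtain X R where X: "w = X @ x # R" "x \<notin> set X" by (meson split_list_first)
  have cR: "count (mset R) x = 1" using assms X by (simp add: count_mset_0_iff[THEN iffD2])
  then have "x \<in> set R" by (metis count_mset_0_iff zero_neq_one)
  then obtain Y Z where Y: "R = Y @ x # Z" "x \<notin> set Y" by (meson split_list_first)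
  have "count (mset Z) x = 0" using cR Y by simp
  then have "x \<notin> set Z" by (simp only: count_mset_0_iff not_False_eq_True)
  then show ?thesis using that X Y by blast
qed

text \<open>With \<open>l = 1\<close> and \<open>h = Suc n\<close> these are the permutations to be
  counted; the recursion leads to general bounds.\<close>

definition lucky_word :: "nat \<Rightarrow> nat \<Rightarrow> nat list \<Rightarrow> bool" where
  "lucky_word l h w \<longleftrightarrow> double_word l h w \<and> nested w \<and> late_repeats h w"

text \<open>The cuts are at the two copies of the smallest letter \<open>l\<close>. By nestedness no
  larger letter occurs on both sides of a copy of \<open>l\<close>; late repeats then empty the part
  after the second copy and order the letters of \<open>A\<close> above those of
  \<open>B\<close>.\<close>

lemma lucky_word_decompose:
  assumes w: "lucky_word l h w" and lh: "l < h"
  obtains m A B where "l < m" "m \<le> h" "lucky_word m h A" "lucky_word (Suc l) m B"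
    "w = A @ l # B @ [l]"
proof -
  have dw: "double_word l h w" and nw: "nested w" and lw: "late_repeats h w"
    using w by (auto simp: lucky_word_def)
  note cw = dw[unfolded double_word_iff_count, rule_format]
  note sw = set_double_word[OF dw]
  have "count (mset w) l = 2" using cw[of l] lh by simp
  then obtain A B C where wABC: "w = A @ l # B @ l # C"
    and notin: "l \<notin> set A" "l \<notin> set B" "l \<notin> set C"
    by (rule count_two_split)
  define N where "N = length A"
  define M where "M = length B"
  have wN: "w ! N = l" by (simp add: wABC N_def)
  have wNM: "w ! (N + Suc M) = l" by (simp add: wABC N_def M_def nth_append)
  have len: "length w = N + Suc (Suc (M + length C))" by (simp add: wABC N_def M_def)
  \<comment> \<open>The first letter of \<open>C\<close> would have to occur before the second
    \<open>l\<close> as well, and its two occurrences would enclose that smaller letter.\<close>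
  have "C = []"
  proof (cases C)
    case (Cons x C')
    have "x \<in> set w" "x \<noteq> l" using Cons wABC notin by auto
    then have x: "l < x" "x < h" using sw by auto
    obtain k where k: "k < N + Suc M" "w ! k = x"
      using late_repeatsD[OF lw, of N "N + Suc M" x] x wN wNM len by auto
    have "w ! (N + Suc (Suc M)) = x" by (simp add: wABC Cons N_def M_def nth_append)
    then have "w ! k < w ! (N + Suc M)"
      using k Cons len by (intro nestedD[OF nw, of k _ "N + Suc (Suc M)"]) simp_all
    then show ?thesis using k wNM x by simp
  qed
  then have wAB: "w = A @ l # B @ [l]" using wABC by simp
  have un: "set A \<union> set B = {Suc l..<h}"
  proof -
    have "set w = insert l (set A \<union> set B)" by (simp add: wAB)
    then have "set A \<union> set B = {l..<h} - {l}" using notin sw by blast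
    also have "\<dots> = {Suc l..<h}" by auto
    finally show ?thesis .
  qed
  have inAB: "l < x \<and> x < h" if "x \<in> set A \<or> x \<in> set B" for x
  proof -
    have "x \<in> {Suc l..<h}" using that un by blast
    then show ?thesis by simp
  qed
  \<comment> \<open>A common letter would enclose the first copy of \<open>l\<close>.\<close>
  have disj: "x \<notin> set B" if "x \<in> set A" for x
  proof
    assume "x \<in> set B"
    then obtain c where c: "c < M" "B ! c = x" by (auto simp: in_set_conv_nth M_def)
    obtain a where a: "a < N" "A ! a = x" using \<open>x \<in> set A\<close> by (auto simp: in_set_conv_nth N_def)
    have wa: "w ! a = x" using a by (simp add: wAB N_def nth_append)
    have wc: "w ! (N + Suc c) = x" using c by (simp add: wAB N_def M_def nth_append)
    have "N + Suc c < length w" using c(1) len by simp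
    moreover have "N < N + Suc c" by simp
    ultimately have "w ! a < w ! N" using a(1) wa wc nestedD[OF nw, of a N "N + Suc c"] by metis
    then show False using wN wa inAB[of x] that by simp
  qed
  have countA: "count (mset A) x = 2" if "x \<in> set A" for x
  proof -
    have "count (mset B) x = 0" using disj[OF that] by (simp add: count_mset_0_iff)
    moreover have "count (mset w) x = count (mset A) x + count (mset B) x"
      using inAB[of x] that by (simp add: wAB)
    moreover have "count (mset w) x = 2" using cw[of x] inAB[of x] that by simp
    ultimately show ?thesis by linarith
  qed
  have countB: "count (mset B) x = 2" if "x \<in> set B" for x
  proof -
    have "count (mset A) x = 0" using disj[of x] that by (auto simp: count_mset_0_iff)
    moreover have "count (mset w) x = count (mset A) x + count (mset B) x"
      using inAB[of x] that by (simp add: wAB)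
    moreover have "count (mset w) x = 2" using cw[of x] inAB[of x] that by simp
    ultimately show ?thesis by linarith
  qed
  have lA: "late_repeats h A" using lw unfolding wAB by (rule late_repeats_appendD)
  \<comment> \<open>Both copies of \<open>x\<close> lie in \<open>A\<close>, so every letter above
    \<open>x\<close> must occur in \<open>A\<close> before the second one, and \<open>y\<close> does
    not occur in \<open>A\<close>.\<close>
  have less: "y < x" if x: "x \<in> set A" and y: "y \<in> set B" for x y
  proof (rule ccontr)
    assume "\<not> y < x"
    moreover have "x \<noteq> y" using disj x y by auto
    ultimately have "x < y" by simp
    obtain X Y Z where A: "A = X @ x # Y @ x # Z"
      using countA[OF x] by (rule count_two_split)
    have "y < h" using inAB[of y] y by blast
    then have "\<exists>k<length X + Suc (length Y). A ! k = y"
      using \<open>x < y\<close> by (intro late_repeatsD[OF lA, of "length X"]) (simp_all add: A nth_append)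
    then obtain k where k: "k < length X + Suc (length Y)" "A ! k = y" by blast
    have "k < length A" using k(1) by (simp add: A)
    then have "y \<in> set A" using nth_mem k(2) by blast
    then show False using disj y by blast
  qed
  \<comment> \<open>For empty \<open>A\<close> the value \<open>h\<close> makes
    \<open>{m..<h}\<close> empty and leaves all letters above \<open>l\<close> to
    \<open>B\<close>.\<close>
  define m where "m = (if A = [] then h else Min (set A))"
  have mA: "m \<le> x" if "x \<in> set A" for x using that by (auto simp: m_def)
  have mB: "x < m" if "x \<in> set B" for x using that inAB[of x] less by (auto simp: m_def)
  have "l < m \<and> m \<le> h"
  proof (cases "A = []")
    case False
    then have "m \<in> set A" by (simp add: m_def)
    then show ?thesis using inAB[of m] by simp
  qed (use lh in \<open>simp add: m_def\<close>)
  then have m: "l < m" "m \<le> h" by blast+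
  have un': "x \<in> set A \<or> x \<in> set B \<longleftrightarrow> l < x \<and> x < h" for x
  proof -
    have "x \<in> set A \<union> set B \<longleftrightarrow> x \<in> {Suc l..<h}" by (simp only: un)
    then show ?thesis by (simp add: Suc_le_eq)
  qed
  have inA: "x \<in> set A \<longleftrightarrow> m \<le> x \<and> x < h" for x
    using un'[of x] mA[of x] mB[of x] m by linarith
  have dA: "double_word m h A"
    unfolding double_word_iff_count inA[symmetric]
  proof
    fix x show "count (mset A) x = (if x \<in> set A then 2 else 0)"
      using countA[of x] by (simp add: count_mset_0_iff)
  qed
  have inB: "x \<in> set B \<longleftrightarrow> Suc l \<le> x \<and> x < m" for x
    using un'[of x] mA[of x] mB[of x] m by linarith
  have dB: "double_word (Suc l) m B"
    unfolding double_word_iff_count inB[symmetric]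
  proof
    fix x show "count (mset B) x = (if x \<in> set B then 2 else 0)"
      using countB[of x] by (simp add: count_mset_0_iff)
  qed
  have nA: "nested A" using nw unfolding wAB by (rule nested_append)
  have "nested ((A @ [l]) @ B @ [l])" using nw by (simp add: wAB)
  then have nB: "nested B" by (rule nested_append(1)[OF nested_append(2)])
  have lB: "late_repeats m B"
    unfolding late_repeats_def
  proof (intro allI impI)
    fix a c j assume *: "a < c" "c < length B" "B ! a = B ! c" "B ! c < j" "j < m"
    have "B ! c \<in> set B" using * by simp
    then have j: "l < j" "j < h" using inB[of "B ! c"] *(4,5) m by linarith+
    have wa: "w ! (N + Suc a) = B ! a" and wc: "w ! (N + Suc c) = B ! c"
      using * by (simp_all add: wAB N_def nth_append)
    have "\<exists>k<N + Suc c. w ! k = j"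
    proof (rule late_repeatsD[OF lw])
      show "N + Suc a < N + Suc c" "N + Suc c < length w" using * len by (simp_all add: M_def)
      show "w ! (N + Suc a) = w ! (N + Suc c)" "w ! (N + Suc c) < j" using *(3,4) wa wc by simp_all
    qed (rule j)
    then obtain k where k: "k < N + Suc c" "w ! k = j" by blast
    \<comment> \<open>The occurrence of \<open>j\<close> lies in \<open>B\<close>: letters of
      \<open>A\<close> are at least \<open>m\<close>, and \<open>j\<close> is strictly between
      \<open>l\<close> and \<open>m\<close>.\<close>
    have "N < k"
    proof (rule ccontr)
      assume "\<not> N < k"
      moreover have "k \<noteq> N" using k(2) wN j(1) by (metis less_irrefl)
      ultimately have "k < N" by simp
      then have "w ! k \<in> set A" by (simp add: wAB N_def nth_append)
      then show False using mA[of j] k(2) *(5) by simp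
    qed
    then obtain k' where k': "k = N + Suc k'" using less_iff_Suc_add[of N k] by auto
    then have "k' < c" using k(1) by simp
    moreover have "w ! (N + Suc k') = B ! k'"
      using \<open>k' < c\<close> *(2) by (simp add: wAB N_def nth_append)
    ultimately have "k' < c" "B ! k' = j" using k(2) k' by simp_all
    then show "\<exists>k<c. B ! k = j" by blast
  qed
  show ?thesis
    using that[OF m _ _ wAB] dA nA lA dB nB lB by (simp add: lucky_word_def)
qed

text \<open>The converse of \<open>lucky_word_decompose\<close>. The letters of \<open>A\<close>,
  those of \<open>B\<close> and \<open>l\<close> form separate ranges, so two equal letters lie both
  in \<open>A\<close>, both in \<open>B\<close>, or are the two copies of \<open>l\<close>.\<close>

lemma lucky_word_compose:
  assumes A: "lucky_word m h A" and B: "lucky_word (Suc l) m B" and m: "l < m" "m \<le> h"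
  shows "lucky_word l h (A @ l # B @ [l])"
proof -
  have dA: "double_word m h A" and nA: "nested A" and lA: "late_repeats h A"
    and dB: "double_word (Suc l) m B" and nB: "nested B" and lB: "late_repeats m B"
    using A B by (auto simp: lucky_word_def)
  define N where "N = length A"
  define M where "M = length B"
  define w where "w = A @ l # B @ [l]"
  have len: "length w = N + Suc (Suc M)" by (simp add: w_def N_def M_def)
  have wA: "w ! k = A ! k" if "k < N" for k using that by (simp add: w_def N_def nth_append)
  have wB: "w ! (N + Suc k) = B ! k" if "k < M" for k
    using that by (simp add: w_def N_def M_def nth_append)
  have wN: "w ! N = l" by (simp add: w_def N_def)
  have wNM: "w ! (N + Suc M) = l" by (simp add: w_def N_def M_def nth_append)
  have inA: "m \<le> A ! k \<and> A ! k < h" if "k < N" for k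
    using nth_mem[of k A] that set_double_word[OF dA] by (simp add: N_def)
  have inB: "l < B ! k \<and> B ! k < m" if "k < M" for k
    using nth_mem[of k B] that set_double_word[OF dB] by (simp add: M_def)
  have idx: "k < N \<and> m \<le> w ! k \<or> (k = N \<or> k = N + Suc M) \<and> w ! k = l
      \<or> N < k \<and> k < N + Suc M \<and> l < w ! k \<and> w ! k < m" if k: "k < length w" for k
  proof -
    consider "k < N" | "k = N" | "k = N + Suc M" | "N < k" "k < N + Suc M"
      using k len by linarith
    then show ?thesis
    proof cases
      case 1
      then show ?thesis using wA[of k] inA[of k] by simp
    next
      case 4
      then have "k = N + Suc (k - Suc N)" "k - Suc N < M" by simp_all
      then show ?thesis using wB[of "k - Suc N"] inB[of "k - Suc N"] 4 by metis
    qed (use wN wNM in simp_all)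
  qed
  have cases: "c < N \<or> N < a \<and> c < N + Suc M \<or> a = N \<and> c = N + Suc M"
    if "a < c" "c < length w" "w ! a = w ! c" for a c
  proof -
    have "a < length w" using that(1,2) by simp
    from idx[OF this] idx[OF that(2)] that(1,3) m(1) show ?thesis by linarith
  qed
  have into: "\<exists>k'. k = N + Suc k'" if "N < k" for k
    using that less_iff_Suc_add[of N k] by auto
  \<comment> \<open>All letters from \<open>m\<close> on have occurred by the end of
    \<open>A\<close>, so the repeats in \<open>B\<close> and the final \<open>l\<close> only have to
    wait for letters below \<open>m\<close>.\<close>
  have exA: "\<exists>k<N. w ! k = j" if "m \<le> j" "j < h" for j
  proof -
    have "j \<in> set A" using set_double_word[OF dA] that by simp
    then show ?thesis using wA by (auto simp: in_set_conv_nth N_def)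
  qed
  have "nested w"
    unfolding nested_def
  proof (intro allI impI)
    fix a b c assume *: "a < b \<and> b < c \<and> c < length w \<and> w ! a = w ! c"
    then have "a < c" by simp
    from cases[OF this] * consider "c < N" | "N < a" "c < N + Suc M" | "a = N" "c = N + Suc M"
      by blast
    then show "w ! a < w ! b"
    proof cases
      case 1
      then have "A ! a = A ! c" using * wA[of a] wA[of c] by simp
      then have "A ! a < A ! b" using * 1 by (intro nestedD[OF nA, of _ _ c]) (simp_all add: N_def)
      then show ?thesis using * 1 wA[of a] wA[of b] by simp
    next
      case 2
      then obtain a' b' c' where e: "a = N + Suc a'" "b = N + Suc b'" "c = N + Suc c'"
        using into[of a] into[of b] into[of c] * by (meson less_trans)
      have lt: "a' < b'" "b' < c'" "c' < M" using * 2 e by simp_all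
      have "B ! a' = B ! c'" using * lt wB[of a'] wB[of c'] by (simp add: e)
      then have "B ! a' < B ! b'" using lt by (intro nestedD[OF nB, of _ _ c']) (simp_all add: M_def)
      then show ?thesis using lt wB[of a'] wB[of b'] by (simp add: e)
    next
      case 3
      have "b < length w" using * by simp
      moreover have "w ! a = l" using 3 wN by simp
      ultimately show ?thesis using idx[of b] * 3 by linarith
    qed
  qed
  moreover have "late_repeats h w"
    unfolding late_repeats_def
  proof (intro allI impI)
    fix a c j assume *: "a < c" "c < length w" "w ! a = w ! c" "w ! c < j" "j < h"
    from cases[OF *(1-3)] consider "c < N" | "N < a" "c < N + Suc M" | "a = N" "c = N + Suc M"
      by blast
    then show "\<exists>k<c. w ! k = j"
    proof cases
      case 1
      then have "A ! a = A ! c" "A ! c < j" using * wA[of a] wA[of c] by simp_all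
      then have "\<exists>k<c. A ! k = j"
        using *(1,5) 1 by (intro late_repeatsD[OF lA, of a]) (simp_all add: N_def)
      then obtain k where "k < c" "A ! k = j" by blast
      then show ?thesis using wA[of k] 1 by auto
    next
      case 2
      then obtain a' c' where e: "a = N + Suc a'" "c = N + Suc c'"
        using into[of a] into[of c] *(1) by (meson less_trans)
      show ?thesis
      proof (cases "j < m")
        case True
        have lt: "a' < c'" "c' < M" using *(1) 2 e by simp_all
        then have "B ! a' = B ! c'" "B ! c' < j" using *(3,4) wB[of a'] wB[of c'] by (simp_all add: e)
        then have "\<exists>k<c'. B ! k = j"
          using lt True by (intro late_repeatsD[OF lB, of a']) (simp_all add: M_def)
        then obtain k where "k < c'" "B ! k = j" by blast
        then show ?thesis using wB[of k] lt e by (intro exI[of _ "N + Suc k"]) simp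
      next
        case False
        then obtain k where "k < N" "w ! k = j" using exA[of j] *(5) by auto
        then show ?thesis using *(1) 2 by (intro exI[of _ k]) simp
      qed
    next
      case 3
      show ?thesis
      proof (cases "j < m")
        case True
        then have "j \<in> set B" using set_double_word[OF dB] *(4) 3 wNM by simp
        then obtain k where "k < M" "B ! k = j" by (auto simp: in_set_conv_nth M_def)
        then show ?thesis using wB[of k] 3 by (intro exI[of _ "N + Suc k"]) simp
      next
        case False
        then obtain k where "k < N" "w ! k = j" using exA[of j] *(5) by auto
        then show ?thesis using 3 by (intro exI[of _ k]) simp
      qed
    qed
  qed
  moreover have "double_word l h w"
    unfolding double_word_iff_count
  proof
    fix x
    have "count (mset w) x = count (mset A) x + count (mset B) x + (if x = l then 2 else 0)"
      by (simp add: w_def)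
    then show "count (mset w) x = (if l \<le> x \<and> x < h then 2 else 0)"
      using dA[unfolded double_word_iff_count, rule_format, of x]
        dB[unfolded double_word_iff_count, rule_format, of x] m by auto
  qed
  ultimately show ?thesis by (simp add: lucky_word_def w_def)
qed

section \<open>Catalan numbers and their convolution\<close>

definition catalan :: "nat \<Rightarrow> real" where
  "catalan n = real ((2 * n) choose n) / real (n + 1)"

text \<open>The ratio of consecutive central binomial coefficients: the absorption identity is used
  twice, with the symmetry of row \<open>2 * n + 1\<close> in between.\<close>

lemma catalan_Suc: "real (n + 2) * catalan (Suc n) = real (4 * n + 2) * catalan n"
proof -
  have "Suc n * (Suc (Suc (2 * n)) choose Suc n) = Suc (Suc (2 * n)) * (Suc (2 * n) choose n)"
    using Suc_times_binomial_eq[of "Suc (2 * n)" n] by (simp only: mult.commute)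
  then have "Suc n * (Suc (Suc (2 * n)) choose Suc n) = Suc n * (2 * (Suc (2 * n) choose n))"
    by (simp add: algebra_simps)
  then have 1: "(Suc (Suc (2 * n)) choose Suc n) = 2 * (Suc (2 * n) choose n)"
    by (simp only: nat_mult_eq_cancel_disj) simp
  have "(Suc (2 * n) choose n) = (Suc (2 * n) choose Suc n)"
    by (subst binomial_symmetric) simp_all
  then have "Suc n * (Suc (2 * n) choose n) = Suc (2 * n) * (2 * n choose n)"
    using Suc_times_binomial_eq[of "2 * n" n] by (simp only: mult.commute)
  moreover have "2 * Suc n = Suc (Suc (2 * n))" by simp
  ultimately have "Suc n * (2 * Suc n choose Suc n) = 2 * (Suc (2 * n) * (2 * n choose n))"
    using 1 by (simp only: mult.left_commute)
  also have "\<dots> = (4 * n + 2) * (2 * n choose n)" by (simp add: algebra_simps)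
  finally have "Suc n * (2 * Suc n choose Suc n) = (4 * n + 2) * (2 * n choose n)" .
  then have "real (n + 1) * real (2 * Suc n choose Suc n)
      = real (4 * n + 2) * real (2 * n choose n)"
    by (metis Suc_eq_plus1 of_nat_mult)
  then have "real (2 * Suc n choose Suc n) = real (4 * n + 2) * real (2 * n choose n) / real (n + 1)"
    by (simp only: nonzero_eq_divide_eq of_nat_eq_0_iff mult.commute)
  moreover have "real (n + 2) * catalan (Suc n) = real (2 * Suc n choose Suc n)"
    unfolding catalan_def by (simp del: mult_Suc_right binomial_Suc_Suc)
  ultimately show ?thesis by (simp only: catalan_def times_divide_eq_right)
qed

text \<open>Pairing \<open>k\<close> with \<open>n - k\<close> gives
  \<open>2 * (\<Sum>k\<le>n. k * catalan k * catalan (n - k)) = n * (\<Sum>k\<le>n. catalan k * catalan (n - k))\<close>,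
  so \<open>catalan_Suc\<close> turns into a recurrence for the convolution.\<close>

lemma catalan_convolution: "(\<Sum>k\<le>n. catalan k * catalan (n - k)) = catalan (Suc n)"
proof (induction n)
  case 0
  show ?case by (simp add: catalan_def)
next
  case (Suc n)
  define S where "S n = (\<Sum>k\<le>n. catalan k * catalan (n - k))" for n
  define T where "T n = (\<Sum>k\<le>n. real k * catalan k * catalan (n - k))" for n
  have sym: "2 * T n = real n * S n" for n
  proof -
    have "T n = (\<Sum>k\<le>n. real (n - k) * catalan k * catalan (n - k))"
      unfolding T_def by (subst sum.nat_diff_reindex[symmetric, of _ "Suc n", unfolded lessThan_Suc_atMost])
        (auto intro!: sum.cong simp: mult_ac)
    then have "2 * T n = (\<Sum>k\<le>n. real k * catalan k * catalan (n - k)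
        + real (n - k) * catalan k * catalan (n - k))"
      by (simp add: T_def sum.distrib)
    also have "\<dots> = (\<Sum>k\<le>n. real n * (catalan k * catalan (n - k)))"
      by (intro sum.cong) (auto simp: of_nat_diff algebra_simps)
    finally show ?thesis by (simp add: S_def sum_distrib_left)
  qed
  \<comment> \<open>Shifting the index turns the weight \<open>k + 1\<close> into
    \<open>k + 2\<close>, the factor with which \<open>catalan_Suc\<close> rewrites
    \<open>catalan (Suc k)\<close>.\<close>
  have "T (Suc n) + S (Suc n) = (\<Sum>k\<le>Suc n. real (k + 1) * catalan k * catalan (Suc n - k))"
    by (simp add: T_def S_def sum.distrib[symmetric] algebra_simps del: sum.atMost_Suc)
  also have "\<dots> = catalan (Suc n) + (\<Sum>k\<le>n. real (k + 2) * catalan (Suc k) * catalan (n - k))"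
    by (subst sum.atMost_Suc_shift) (simp add: catalan_def[of 0])
  also have "(\<Sum>k\<le>n. real (k + 2) * catalan (Suc k) * catalan (n - k))
      = (\<Sum>k\<le>n. 4 * (real k * catalan k * catalan (n - k)) + 2 * (catalan k * catalan (n - k)))"
    by (intro sum.cong refl) (simp only: catalan_Suc, simp add: algebra_simps)
  also have "\<dots> = 4 * T n + 2 * S n"
    by (simp add: T_def S_def sum.distrib sum_distrib_left)
  finally have "2 * (T (Suc n) + S (Suc n)) = 2 * (catalan (Suc n) + 4 * T n + 2 * S n)"
    by simp
  then have "real (n + 3) * S (Suc n) = 2 * catalan (Suc n) + 4 * (real n * S n) + 4 * S n"
    using sym[of n] sym[of "Suc n"] by (simp add: algebra_simps)
  \<comment> \<open>By the induction hypothesis the right-hand side becomes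
    \<open>(4 * n + 6) * catalan (Suc n)\<close>, and \<open>catalan_Suc\<close> applies once
    more.\<close>
  also have "S n = catalan (Suc n)" using Suc.IH by (simp add: S_def)
  also have "2 * catalan (Suc n) + 4 * (real n * catalan (Suc n)) + 4 * catalan (Suc n)
      = real (n + 3) * catalan (Suc (Suc n))"
    using catalan_Suc[of "Suc n"] by (simp add: algebra_simps)
  finally show ?case by (simp add: S_def)
qed

section \<open>Counting by the Catalan recurrence\<close>

text \<open>Strong induction on the number of distinct letters, with \<open>l\<close> arbitrary
  because both factors use shifted intervals. For \<open>n = Suc r\<close>, words correspond to
  triples \<open>(k, A, B)\<close> with \<open>k\<close> distinct letters in \<open>B\<close> and
  \<open>r - k\<close> in \<open>A\<close>.\<close>

lemma card_lucky_words:
  "finite {w. lucky_word l (l + n) w} \<and> real (card {w. lucky_word l (l + n) w}) = catalan n"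
proof (induction n arbitrary: l rule: less_induct)
  case (less n)
  show ?case
  proof (cases n)
    case 0
    have "{w. lucky_word l (l + n) w} = {[]}"
      using 0 by (auto simp: lucky_word_def double_word_def nested_def late_repeats_def)
    then show ?thesis using 0 by (simp add: catalan_def)
  next
    case (Suc r)
    define U where "U k = {A. lucky_word (Suc l + k) (l + n) A}" for k
    define V where "V k = {B. lucky_word (Suc l) (Suc l + k) B}" for k
    define f where "f = (\<lambda>(k :: nat, A, B). A @ l # B @ [l])"
    have U: "finite (U k)" "real (card (U k)) = catalan (r - k)" if "k \<le> r" for k
    proof -
      have "Suc l + k + (r - k) = l + n" using that Suc by simp
      then show "finite (U k)" "real (card (U k)) = catalan (r - k)"
        using less.IH[of "r - k" "Suc l + k"] Suc by (simp_all add: U_def)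
    qed
    have V: "finite (V k)" "real (card (V k)) = catalan k" if "k \<le> r" for k
      using less.IH[of k "Suc l"] Suc that by (simp_all add: V_def)
    define D where "D = (SIGMA k:{..r}. U k \<times> V k)"
    have eq: "{w. lucky_word l (l + n) w} = f ` D"
    proof (intro set_eqI iffI)
      fix w assume "w \<in> {w. lucky_word l (l + n) w}"
      then have "lucky_word l (l + n) w" "l < l + n" using Suc by simp_all
      then obtain m A B where m: "l < m" "m \<le> l + n" "lucky_word m (l + n) A" "lucky_word (Suc l) m B"
        "w = A @ l # B @ [l]" by (rule lucky_word_decompose)
      define k where "k = m - Suc l"
      have mk: "m = Suc l + k" "k \<le> r" using m Suc by (auto simp: k_def)
      have "(k, A, B) \<in> D" using m(3,4) mk by (simp add: D_def U_def V_def)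
      then show "w \<in> f ` D" using m(5) by (force simp: f_def)
    next
      fix w assume "w \<in> f ` D"
      then obtain k A B where k: "k \<le> r" "A \<in> U k" "B \<in> V k" "w = A @ l # B @ [l]"
        by (auto simp: f_def D_def)
      then show "w \<in> {w. lucky_word l (l + n) w}"
        using lucky_word_compose[of "Suc l + k" "l + n" A l B] Suc by (simp add: U_def V_def)
    qed
    have inj: "inj_on f D"
    proof (rule inj_onI)
      fix x y assume xy: "x \<in> D" "y \<in> D" "f x = f y"
      obtain k A B where x: "x = (k, A, B)" by (cases x)
      obtain k' A' B' where y: "y = (k', A', B')" by (cases y)
      have A: "k \<le> r" "double_word (Suc l + k) (l + n) A"
        and A': "k' \<le> r" "double_word (Suc l + k') (l + n) A'"
        using xy by (auto simp: x y D_def U_def lucky_word_def)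
      \<comment> \<open>The first \<open>l\<close> in the word thus marks the end of
        \<open>A\<close>, which makes the cut unique.\<close>
      have "l \<notin> set A" "l \<notin> set A'"
        using set_double_word[OF A(2)] set_double_word[OF A'(2)] by auto
      moreover have "A @ l # B @ [l] = A' @ l # B' @ [l]" using xy(3) by (simp add: x y f_def)
      ultimately have AB: "A = A'" "B = B'"
        by (auto simp: append_eq_append_conv2 append_eq_Cons_conv Cons_eq_append_conv)
      \<comment> \<open>The length of \<open>A\<close> is \<open>2 * (r - k)\<close>, and
        \<open>k \<le> r\<close> keeps the subtraction from truncating, so it determines
        \<open>k\<close>.\<close>
      have "k = k'"
        using length_double_word[OF A(2)] length_double_word[OF A'(2)] AB A(1) A'(1) Suc by simp
      then show "x = y" using AB by (simp add: x y)
    qed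
    have fin: "finite D" using U V by (auto simp: D_def)
    have "real (card D) = (\<Sum>k\<le>r. real (card (U k)) * real (card (V k)))"
      unfolding D_def using U V by (subst card_SigmaI) (auto simp: card_cartesian_product)
    also have "\<dots> = (\<Sum>k\<le>r. catalan k * catalan (r - k))"
      using U V by (intro sum.cong) (auto simp: mult.commute)
    also have "\<dots> = catalan n" using Suc catalan_convolution by simp
    finally have "real (card D) = catalan n" .
    then show ?thesis using fin by (simp add: eq card_image[OF inj])
  qed
qed

theorem corollary5p10:
  fixes n :: nat
  assumes "n \<ge> 1"
  shows "real (card {w \<in> stirling_permutations n.
            card {i. i < length (displacement_composition w) \<and>
                     displacement_composition w ! i \<noteq> 0} = n})
         = 1 / (real n + 1) * real ((2 * n) choose n)"
proof -
  have "stirling_permutations n = {w. double_word 1 (Suc n) w \<and> nested w}"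
    by (simp add: stirling_permutations_def double_word_def nested_def
        atLeastLessThanSuc_atLeastAtMost)
  then have "{w \<in> stirling_permutations n.
      card {i. i < length (displacement_composition w) \<and> displacement_composition w ! i \<noteq> 0} = n}
    = {w. lucky_word 1 (1 + n) w}"
    using card_nonzero_displacement_iff by (auto simp: lucky_word_def)
  then show ?thesis using card_lucky_words[of 1 n] by (simp add: catalan_def add.commute)
qed

end
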